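(* Suppose $d$ is twice differentiable on its domain $\{(\beta,c):c^2<1,\beta<2\sqrt{1-c^2}\}$. Fix $k<2$ and consider the curve $\Gamma_k=\{(\beta,c):0\le c<1,\ \beta=k\sqrt{1-c^2}\}$. Then $d_{cc}$ changes sign at most once along $\Gamma_k$. That is, there do not exist $0\le c_1<c_2<c_3<1$ such that the values $d_{cc}(k\sqrt{1-c_i^2},c_i)$, $i=1,2,3$, are nonzero and alternate in sign.
   Context: Setting: $p>1$, $f\in C^2$ homogeneous of degree $p$ (i.e. $f(\lambda s)=\lambda^pf(s)$ for $\lambda>0$), and $F=\int_0^sf$, taking a positive value somewhere. Definitions: - $I(u)=\int u_{xx}^2-\beta u_x^2+(1-c^2)u^2$ and $K(u)=(p+1)\int F(u)$. - $m(\beta,c)=\inf\{I/K^{2/(p+1)}:u\in H^2,K(u)>0\}$. - $d(\beta,c)=\frac{p-1}{2(p+1)}m(\beta,c)^{(p+1)/(p-1)}$. - $d_{cc}=\partial_c^2d$. *)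

theory Defs
  imports "HOL-Analysis.Analysis"
begin

definition C2_fun :: "(real \<Rightarrow> real) \<Rightarrow> bool" where
  "C2_fun f \<longleftrightarrow> (\<exists>f1 f2. (\<forall>x. (f has_real_derivative f1 x) (at x))
      \<and> (\<forall>x. (f1 has_real_derivative f2 x) (at x)) \<and> continuous_on UNIV f2)"

definition Fprim :: "(real \<Rightarrow> real) \<Rightarrow> real \<Rightarrow> real" where
  "Fprim f s = (LBINT t=0..s. f t)"

text \<open>H^2(R): u and u' in L^2, u' absolutely continuous with derivative w in L^2
  (continuously differentiable representative of the Sobolev class).\<close>
definition H2 :: "(real \<Rightarrow> real) \<Rightarrow> bool" where
  "H2 u \<longleftrightarrow> (\<forall>x. u differentiable (at x))
     \<and> integrable lborel (\<lambda>x. (u x)\<^sup>2)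
     \<and> integrable lborel (\<lambda>x. (deriv u x)\<^sup>2)
     \<and> (\<exists>w. w \<in> borel_measurable borel \<and> integrable lborel (\<lambda>x. (w x)\<^sup>2)
           \<and> (\<forall>x. deriv u x - deriv u 0 = (LBINT t=0..x. w t)))"

definition Ifun :: "real \<Rightarrow> real \<Rightarrow> (real \<Rightarrow> real) \<Rightarrow> real" where
  "Ifun \<beta> c u = integral\<^sup>L lebesgue
     (\<lambda>x. (deriv (deriv u) x)\<^sup>2 - \<beta> * (deriv u x)\<^sup>2 + (1 - c\<^sup>2) * (u x)\<^sup>2)"

definition Kfun :: "real \<Rightarrow> (real \<Rightarrow> real) \<Rightarrow> (real \<Rightarrow> real) \<Rightarrow> real" where
  "Kfun p f u = (p + 1) * integral\<^sup>L lebesgue (\<lambda>x. Fprim f (u x))"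

definition mfun :: "real \<Rightarrow> (real \<Rightarrow> real) \<Rightarrow> real \<Rightarrow> real \<Rightarrow> real" where
  "mfun p f \<beta> c = Inf {Ifun \<beta> c u / (Kfun p f u) powr (2 / (p + 1)) | u. H2 u \<and> Kfun p f u > 0}"

definition dfun :: "real \<Rightarrow> (real \<Rightarrow> real) \<Rightarrow> real \<Rightarrow> real \<Rightarrow> real" where
  "dfun p f \<beta> c = (p - 1) / (2 * (p + 1)) * (mfun p f \<beta> c) powr ((p + 1) / (p - 1))"

definition dom_d :: "(real \<times> real) set" where
  "dom_d = {(\<beta>, c). c\<^sup>2 < 1 \<and> \<beta> < 2 * sqrt (1 - c\<^sup>2)}"

definition twice_differentiable_on :: "(real \<times> real \<Rightarrow> real) \<Rightarrow> (real \<times> real) set \<Rightarrow> bool" where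
  "twice_differentiable_on g S \<longleftrightarrow> (\<forall>z\<in>S. g differentiable (at z)
      \<and> (\<lambda>y. frechet_derivative g (at y) (1, 0)) differentiable (at z)
      \<and> (\<lambda>y. frechet_derivative g (at y) (0, 1)) differentiable (at z))"

definition d_cc :: "real \<Rightarrow> (real \<Rightarrow> real) \<Rightarrow> real \<Rightarrow> real \<Rightarrow> real" where
  "d_cc p f \<beta> c = deriv (\<lambda>c1. deriv (\<lambda>c2. dfun p f \<beta> c2) c1) c"

end

theory Submission
  imports Defs
begin

text \<open>
  Put \<open>\<omega> = sqrt (1 - c\<^sup>2)\<close>. Replacing \<open>u x\<close> by \<open>u (sqrt \<omega> * x)\<close> turns the minimisation problem
  at \<open>(\<beta>, c)\<close> into the one at \<open>(\<beta> / \<omega>, 0)\<close>, up to a power of \<open>\<omega>\<close>; hence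
  \<open>d \<beta> c = \<omega> powr a * h (\<beta> / \<omega>)\<close> with \<open>h b = d b 0\<close>. Differentiating twice in \<open>c\<close> and putting
  \<open>\<beta> = k * \<omega>\<close>, one finds that \<open>d_cc\<close> is \<open>\<omega> powr (a - 4)\<close> times an affine function of \<open>c\<^sup>2\<close> whose
  coefficients depend only on \<open>k\<close>, so it changes sign at most once.

  Scaling a real infimum needs boundedness from below, which for \<open>\<beta> \<le> 2\<close>, \<open>c = 0\<close> follows from
  \<open>\<integral> u'\<^sup>2 = - \<integral> u u''\<close>: then \<open>I u = \<integral> (u'' + u)\<^sup>2 + (2 - \<beta>) \<integral> u'\<^sup>2\<close>.
\<close>

subsection \<open>Indefinite integrals\<close>

text \<open>Lebesgue differentiation. \<open>integrable_ccontinuous_explicit\<close> averages over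
  cubes with lower corner \<open>x\<close>, here \<open>{x..x + h}\<close>, which gives the
  derivative from the right only.\<close>

lemma AE_right_derivative_indefinite_integral:
  fixes w W :: "real \<Rightarrow> real"
  assumes w: "\<And>a b. w integrable_on {a..b}"
    and W: "\<And>a b. a \<le> b \<Longrightarrow> W b - W a = integral {a..b} w"
  shows "AE x in lebesgue. (W has_real_derivative w x) (at_right x)"
proof -
  obtain N where N: "negligible N"
    and lim: "\<And>x e. \<lbrakk>x \<notin> N; 0 < e\<rbrakk> \<Longrightarrow> \<exists>d>0. \<forall>h. 0 < h \<and> h < d \<longrightarrow>
        norm (integral (cbox x (x + h *\<^sub>R One)) w /\<^sub>R h ^ DIM(real) - w x) < e"
    using integrable_ccontinuous_explicit[of w] w by (auto simp: cbox_interval)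
  have "(W has_real_derivative w x) (at_right x)" if xN: "x \<notin> N" for x
    unfolding has_field_derivative_iff Lim_within
  proof (intro allI impI)
    fix e :: real assume "0 < e"
    then obtain d where "d > 0" and d: "\<And>h. 0 < h \<and> h < d \<Longrightarrow>
        \<bar>integral {x..x + h} w / h - w x\<bar> < e"
      using lim[OF xN \<open>0 < e\<close>] by (auto simp: divide_inverse mult.commute)
    have "\<bar>(W y - W x) / (y - x) - w x\<bar> < e" if "x < y" "y < x + d" for y
      using d[of "y - x"] that by (simp add: W)
    then show "\<exists>d>0. \<forall>y\<in>{x<..}. 0 < dist y x \<and> dist y x < d \<longrightarrow>
        dist ((W y - W x) / (y - x)) (w x) < e"
      using \<open>d > 0\<close> by (intro exI[of _ d]) (auto simp: dist_real_def)
  qed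
  then show ?thesis
    using N by (intro AE_I'[of N]) (auto simp: negligible_iff_null_sets)
qed

text \<open>Reflection is differentiable, so it maps null sets to null sets.\<close>

lemma AE_lebesgue_reflect:
  fixes P :: "real \<Rightarrow> bool"
  assumes "AE x in lebesgue. P x"
  shows "AE x in lebesgue. P (- x)"
proof -
  obtain N where N: "N \<in> null_sets lebesgue" "{x. \<not> P x} \<subseteq> N"
    using assms by (auto simp: eventually_ae_filter)
  have "negligible (uminus ` N)"
    using N(1) by (intro negligible_differentiable_image_negligible)
      (auto simp: negligible_iff_null_sets intro!: derivative_intros)
  moreover have "{x. \<not> P (- x)} \<subseteq> uminus ` N"
  proof
    fix x assume "x \<in> {x. \<not> P (- x)}"
    then have "- x \<in> N" using N(2) by auto
    then show "x \<in> uminus ` N" by (intro image_eqI[of _ _ "- x"]) auto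
  qed
  ultimately show ?thesis
    by (intro AE_I'[of "uminus ` N"]) (auto simp: negligible_iff_null_sets)
qed

text \<open>The one-sided result applied to \<open>\<lambda>x. - W (- x)\<close>, an indefinite
  integral of \<open>\<lambda>x. w (- x)\<close>, supplies the left derivative of \<open>W\<close>
  after reflecting the exceptional null set.\<close>

lemma AE_derivative_indefinite_integral:
  fixes w W :: "real \<Rightarrow> real"
  assumes w: "\<And>a b. w integrable_on {a..b}"
    and W: "\<And>a b. a \<le> b \<Longrightarrow> W b - W a = integral {a..b} w"
  shows "AE x in lebesgue. (W has_real_derivative w x) (at x)"
proof -
  have "AE x in lebesgue. ((\<lambda>x. - W (- x)) has_real_derivative w (- x)) (at_right x)"
  proof (rule AE_right_derivative_indefinite_integral)
    show "(\<lambda>x. w (- x)) integrable_on {a..b}" for a b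
      using w[of "-b" "-a"]
        Henstock_Kurzweil_Integration.integrable_reflect_real[where f = w and a = "-b" and b = "-a"]
      by simp
    show "- W (- b) - - W (- a) = integral {a..b} (\<lambda>x. w (- x))" if "a \<le> b" for a b
      using W[of "-b" "-a"] that
        Henstock_Kurzweil_Integration.integral_reflect_real[where f = w and a = "-b" and b = "-a"]
      by simp
  qed
  from AE_lebesgue_reflect[OF this]
  have "AE x in lebesgue. ((\<lambda>x. - W (- x)) has_real_derivative w x) (at_right (- x))"
    by simp
  moreover have "AE x in lebesgue. (W has_real_derivative w x) (at_right x)"
    by (rule AE_right_derivative_indefinite_integral[OF w W])
  ultimately show ?thesis
  proof eventually_elim
    case (elim x)
    \<comment> \<open>Reflection carries left neighbourhoods of \<open>x\<close> to right
      neighbourhoods of \<open>- x\<close>, where the derivative is known.\<close>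
    have "((\<lambda>x. - W (- x)) \<circ> uminus has_real_derivative w x * (- 1)) (at_left x)"
    proof (rule DERIV_image_chain)
      show "((\<lambda>x. - W (- x)) has_real_derivative w x) (at (- x) within uminus ` {..<x})"
        using elim(1) by simp
    qed (auto intro!: derivative_eq_intros)
    then have "((\<lambda>x. - (((\<lambda>x. - W (- x)) \<circ> uminus) x)) has_real_derivative - (w x * (- 1))) (at_left x)"
      by (rule DERIV_minus)
    then have "(W has_real_derivative w x) (at_left x)"
      by (simp add: o_def)
    with elim(2) show ?case
      unfolding has_field_derivative_iff by (intro filterlim_split_at_real)
  qed
qed

section \<open>Square-integrable functions, integration by parts and decay at infinity\<close>

lemma set_integrable_of_square_integrable:
  fixes w :: "real \<Rightarrow> real"
  assumes [measurable]: "w \<in> borel_measurable borel"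
    and "integrable lborel (\<lambda>x. (w x)\<^sup>2)"
  shows "set_integrable lborel {a..b} w"
  unfolding set_integrable_def
proof (rule Bochner_Integration.integrable_bound)
  show "integrable lborel (\<lambda>x. indicator {a..b} x + (w x)\<^sup>2 :: real)"
    using assms by (intro Bochner_Integration.integrable_add)
      (auto simp: integrable_indicator_iff emeasure_lborel_Icc_eq)
  have "\<bar>t\<bar> \<le> 1 + t\<^sup>2" for t :: real
    using sum_squares_bound[of "\<bar>t\<bar>" 1] by simp
  then show "AE x in lborel. norm (indicator {a..b} x *\<^sub>R w x) \<le> norm (indicator {a..b} x + (w x)\<^sup>2)"
    by (intro always_eventually allI) (auto simp: indicator_def)
qed measurable

lemma integrable_mult_of_square_integrable:
  fixes f g :: "'a \<Rightarrow> real"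
  assumes [measurable]: "f \<in> borel_measurable M" "g \<in> borel_measurable M"
    and "integrable M (\<lambda>x. (f x)\<^sup>2)" "integrable M (\<lambda>x. (g x)\<^sup>2)"
  shows "integrable M (\<lambda>x. f x * g x)"
proof (rule Bochner_Integration.integrable_bound)
  show "integrable M (\<lambda>x. (f x)\<^sup>2 + (g x)\<^sup>2)"
    using assms by auto
  have "\<bar>s * t\<bar> \<le> s\<^sup>2 + t\<^sup>2" for s t :: real
    using sum_squares_bound[of "\<bar>s\<bar>" "\<bar>t\<bar>"] abs_ge_zero[of "s * t"]
    unfolding abs_mult power2_abs by linarith
  then show "AE x in M. norm (f x * g x) \<le> norm ((f x)\<^sup>2 + (g x)\<^sup>2)"
    by (intro always_eventually) auto
qed measurable

text \<open>Each summand equals boundary terms plus or minus the integral of \<open>f s * g t\<close> over the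
  triangle \<open>s \<le> t\<close>, taken in the two orders.\<close>
lemma integral_by_parts_indefinite:
  fixes f g F G :: "real \<Rightarrow> real"
  assumes "a \<le> b"
    and f: "set_integrable lborel {a..b} f" and g: "set_integrable lborel {a..b} g"
    and F: "\<And>x y. \<lbrakk>a \<le> x; x \<le> y; y \<le> b\<rbrakk> \<Longrightarrow> F y - F x = (LBINT t:{x..y}. f t)"
    and G: "\<And>x y. \<lbrakk>a \<le> x; x \<le> y; y \<le> b\<rbrakk> \<Longrightarrow> G y - G x = (LBINT t:{x..y}. g t)"
  shows "(LBINT x:{a..b}. f x * G x) + (LBINT x:{a..b}. F x * g x) = F b * G b - F a * G a"
proof -
  \<comment> \<open>Truncation makes both functions integrable on the whole line, so Fubini can be
    used on the plane.\<close>
  define f' where "f' x = indicator {a..b} x * f x" for x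
  define g' where "g' x = indicator {a..b} x * g x" for x
  have f'[simp]: "integrable lborel f'" and g'[simp]: "integrable lborel g'"
    using f g by (auto simp: set_integrable_def f'_def[abs_def] g'_def[abs_def])
  have [measurable]: "f' \<in> borel_measurable borel" "g' \<in> borel_measurable borel"
    using borel_measurable_integrable[OF f'] borel_measurable_integrable[OF g'] by auto
  define h where "h s t = (if s \<le> t then f' s * g' t else 0)" for s t
  have "integrable (lborel \<Otimes>\<^sub>M lborel) (\<lambda>(s, t). f' s * g' t)"
  proof (rule lborel_pair.Fubini_integrable)
    show "integrable lborel (\<lambda>s. \<integral>t. norm (case (s, t) of (s, t) \<Rightarrow> f' s * g' t) \<partial>lborel)"
      using integrable_norm[OF f'] by (simp add: abs_mult)
    show "AE s in lborel. integrable lborel (\<lambda>t. case (s, t) of (s, t) \<Rightarrow> f' s * g' t)"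
      by simp
  qed measurable
  then have h: "integrable (lborel \<Otimes>\<^sub>M lborel) (\<lambda>(s, t). h s t)"
    by (rule Bochner_Integration.integrable_bound) (auto simp: h_def)
  have h_right: "(\<integral>t. h s t \<partial>lborel) = f' s * (G b - G s)" for s
  proof (cases "s \<in> {a..b}")
    case True
    then have "h s t = f' s * (indicator {s..b} t *\<^sub>R g t)" for t
      by (auto simp: h_def g'_def indicator_def)
    then show ?thesis
      using True G[of s b] by (simp add: set_lebesgue_integral_def)
  next
    case False
    then have "f' s = 0" by (simp add: f'_def)
    then show ?thesis by (simp add: h_def cong: if_cong)
  qed
  have h_left: "(\<integral>s. h s t \<partial>lborel) = (F t - F a) * g' t" for t
  proof (cases "t \<in> {a..b}")
    case True
    then have "h s t = (indicator {a..t} s *\<^sub>R f s) * g' t" for s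
      by (auto simp: h_def f'_def indicator_def)
    then show ?thesis
      using True F[of a t] by (simp add: set_lebesgue_integral_def)
  next
    case False
    then have "g' t = 0" by (simp add: g'_def)
    then show ?thesis by (simp add: h_def cong: if_cong)
  qed
  have int_r: "integrable lborel (\<lambda>s. f' s * (G b - G s))"
    using lborel_pair.integrable_fst[OF h] by (simp add: h_right)
  have int_l: "integrable lborel (\<lambda>t. (F t - F a) * g' t)"
    using lborel_pair.integrable_snd[OF h] by (simp add: h_left)
  have sum_f': "(\<integral>s. f' s \<partial>lborel) = F b - F a" and sum_g': "(\<integral>s. g' s \<partial>lborel) = G b - G a"
    using F[of a b] G[of a b] \<open>a \<le> b\<close> by (simp_all add: f'_def g'_def set_lebesgue_integral_def)
  have "(LBINT x:{a..b}. f x * G x) = (\<integral>s. f' s * G b - f' s * (G b - G s) \<partial>lborel)"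
    by (simp add: set_lebesgue_integral_def f'_def right_diff_distrib mult.assoc)
  also have "\<dots> = (F b - F a) * G b - (\<integral>s. f' s * (G b - G s) \<partial>lborel)"
    using int_r by (subst Bochner_Integration.integral_diff) (auto simp: sum_f')
  finally have 1: "(LBINT x:{a..b}. f x * G x) = (F b - F a) * G b - (\<integral>s. f' s * (G b - G s) \<partial>lborel)" .
  have "(LBINT x:{a..b}. F x * g x) = (\<integral>t. F a * g' t + (F t - F a) * g' t \<partial>lborel)"
    by (simp add: set_lebesgue_integral_def g'_def left_diff_distrib mult.left_commute)
  also have "\<dots> = F a * (G b - G a) + (\<integral>t. (F t - F a) * g' t \<partial>lborel)"
    using int_l by (subst Bochner_Integration.integral_add) (auto simp: sum_g')
  finally have 2: "(LBINT x:{a..b}. F x * g x) = F a * (G b - G a) + (\<integral>t. (F t - F a) * g' t \<partial>lborel)" .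
  have "(\<integral>t. (F t - F a) * g' t \<partial>lborel) = (\<integral>s. f' s * (G b - G s) \<partial>lborel)"
    using lborel_pair.Fubini_integral[OF h] unfolding h_right h_left .
  with 1 2 show ?thesis
    by (simp add: left_diff_distrib right_diff_distrib)
qed

text \<open>A nonzero limit would keep \<open>f\<close> above \<open>\<bar>L\<bar> / 2\<close> in
  absolute value on some half-line, which would then have finite measure although it contains
  intervals of every length \<open>n\<close>.\<close>

lemma integrable_tendsto_at_top_imp_zero:
  fixes f :: "real \<Rightarrow> real"
  assumes "integrable lborel f" and "(f \<longlongrightarrow> L) at_top"
  shows "L = 0"
proof (rule ccontr)
  assume "L \<noteq> 0"
  then have "eventually (\<lambda>x. \<bar>L\<bar> / 2 < \<bar>f x\<bar>) at_top"
    using tendsto_rabs[OF assms(2)] by (intro order_tendstoD) auto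
  then obtain X where X: "\<And>x. X \<le> x \<Longrightarrow> \<bar>L\<bar> / 2 < \<bar>f x\<bar>"
    by (auto simp: eventually_at_top_linorder)
  have "integrable lborel (indicator {X..} :: real \<Rightarrow> real)"
  proof (rule Bochner_Integration.integrable_bound)
    show "integrable lborel (\<lambda>x. 2 / \<bar>L\<bar> * f x)"
      using assms(1) by simp
    show "AE x in lborel. norm (indicator {X..} x :: real) \<le> norm (2 / \<bar>L\<bar> * f x)"
      using X \<open>L \<noteq> 0\<close>
      by (intro AE_I2) (auto simp: indicator_def abs_mult field_simps intro: less_imp_le)
  qed measurable
  then have "emeasure lborel {X..} < \<infinity>"
    by (simp add: integrable_indicator_iff)
  moreover have "emeasure lborel {X..X + real n} \<le> emeasure lborel {X..}" for n
    by (intro emeasure_mono) auto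
  ultimately show False
    using ennreal_Ex_less_of_nat[of "emeasure lborel {X..}"]
    by (auto simp: emeasure_lborel_Icc_eq ennreal_of_nat_eq_real_of_nat not_le[symmetric])
qed

subsection \<open>The quadratic functional on \<open>H\<^sup>2\<close>\<close>

text \<open>A weak second derivative; the classical \<open>deriv (deriv u)\<close> agrees with it only almost
  everywhere and is a junk value where \<open>deriv u\<close> is not differentiable.\<close>
definition weak_deriv2 :: "(real \<Rightarrow> real) \<Rightarrow> (real \<Rightarrow> real) \<Rightarrow> bool" where
  "weak_deriv2 u w \<longleftrightarrow> w \<in> borel_measurable borel \<and> integrable lborel (\<lambda>x. (w x)\<^sup>2)
     \<and> (\<forall>x. deriv u x - deriv u 0 = (LBINT t=0..x. w t))"

lemma H2_iff:
  "H2 u \<longleftrightarrow> (\<forall>x. u differentiable (at x)) \<and> integrable lborel (\<lambda>x. (u x)\<^sup>2)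
     \<and> integrable lborel (\<lambda>x. (deriv u x)\<^sup>2) \<and> (\<exists>w. weak_deriv2 u w)"
  by (simp add: H2_def weak_deriv2_def)

context
  fixes u w :: "real \<Rightarrow> real"
  assumes w: "weak_deriv2 u w"
begin

lemma weak_deriv2_measurable [measurable]: "w \<in> borel_measurable borel"
  using w by (simp add: weak_deriv2_def)

lemma weak_deriv2_square_integrable: "integrable lborel (\<lambda>x. (w x)\<^sup>2)"
  using w by (simp add: weak_deriv2_def)

lemma weak_deriv2_set_integrable: "set_integrable lborel {a..b} w"
  by (rule set_integrable_of_square_integrable)
    (simp_all add: weak_deriv2_measurable weak_deriv2_square_integrable)

lemma weak_deriv2_diff:
  assumes "a \<le> b"
  shows "deriv u b - deriv u a = (LBINT t:{a..b}. w t)"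
proof -
  have *: "interval_lebesgue_integrable lborel (ereal a) (ereal b) w" if "a \<le> b" for a b
    using that unfolding interval_lebesgue_integrable_def
    by (auto intro!: set_integrable_subset[OF weak_deriv2_set_integrable[of a b]])
  \<comment> \<open>The order of 0, \<open>a\<close> and \<open>b\<close> is unknown; additivity of
    oriented integrals asks for integrability over the hull of all three points.\<close>
  have "interval_lebesgue_integrable lborel
      (ereal (min 0 (min a b))) (ereal (max 0 (max a b))) w"
    by (rule *) simp
  then have "(LBINT t=ereal 0..a. w t) + (LBINT t=a..b. w t) = (LBINT t=ereal 0..b. w t)"
    by (intro interval_integral_sum) (simp add: ereal_min ereal_max)
  then show ?thesis
    using w assms by (simp add: weak_deriv2_def interval_integral_Icc zero_ereal_def)
      (smt (verit))
qed

lemma weak_deriv2_diff_integral: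
  "a \<le> b \<Longrightarrow> deriv u b - deriv u a = integral {a..b} w"
  using weak_deriv2_diff weak_deriv2_set_integrable set_borel_integral_eq_integral(2) by metis

lemma weak_deriv2_integrable_on: "w integrable_on {a..b}"
  using weak_deriv2_set_integrable set_borel_integral_eq_integral(1) by metis

lemma continuous_deriv_of_weak_deriv2: "continuous_on UNIV (deriv u)"
proof -
  have "isCont (deriv u) x" for x
  proof -
    \<comment> \<open>Starting the indefinite integral at \<open>x - 1\<close> puts \<open>x\<close>
      in the interior of the interval.\<close>
    have "continuous_on {x - 1..x + 1} (\<lambda>y. deriv u (x - 1) + integral {x - 1..y} w)"
      by (intro continuous_intros indefinite_integral_continuous_1 weak_deriv2_integrable_on)
    then have "continuous_on {x - 1..x + 1} (deriv u)"
      by (rule continuous_on_eq) (auto simp flip: weak_deriv2_diff_integral)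
    then show ?thesis
      by (rule continuous_on_interior) auto
  qed
  then show ?thesis by (simp add: continuous_at_imp_continuous_on)
qed

lemma deriv_borel_of_weak_deriv2 [measurable]: "deriv u \<in> borel_measurable borel"
  using continuous_deriv_of_weak_deriv2 by (rule borel_measurable_continuous_onI)

text \<open>Lebesgue differentiation for \<open>deriv u\<close>. It allows the classical second
  derivative in \<open>Ifun\<close> to be replaced by \<open>w\<close>.\<close>

lemma AE_deriv_deriv_eq_weak_deriv2: "AE x in lebesgue. deriv (deriv u) x = w x"
  using AE_derivative_indefinite_integral[OF weak_deriv2_integrable_on weak_deriv2_diff_integral]
  by (rule AE_mp) (auto simp: DERIV_imp_deriv)

context
  assumes u: "H2 u"
begin

lemma H2_has_derivative: "(u has_real_derivative deriv u x) (at x)"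
  using u by (simp add: H2_def DERIV_deriv_iff_real_differentiable)

lemma H2_borel [measurable]: "u \<in> borel_measurable borel"
  by (intro borel_measurable_continuous_onI continuous_at_imp_continuous_on ballI
      DERIV_isCont[OF H2_has_derivative])

lemma H2_square_integrable:
  "integrable lborel (\<lambda>x. (u x)\<^sup>2)" "integrable lborel (\<lambda>x. (deriv u x)\<^sup>2)"
  using u by (simp_all add: H2_def)

lemma Ifun_eq_weak_deriv2:
  "Ifun \<beta> c u = (\<integral>x. (w x)\<^sup>2 \<partial>lborel) - \<beta> * (\<integral>x. (deriv u x)\<^sup>2 \<partial>lborel)
     + (1 - c\<^sup>2) * (\<integral>x. (u x)\<^sup>2 \<partial>lborel)"
proof -
  let ?J = "\<lambda>x. (w x)\<^sup>2 - \<beta> * (deriv u x)\<^sup>2 + (1 - c\<^sup>2) * (u x)\<^sup>2"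
  let ?I = "\<lambda>x. (deriv (deriv u) x)\<^sup>2 - \<beta> * (deriv u x)\<^sup>2 + (1 - c\<^sup>2) * (u x)\<^sup>2"
  have J: "?J \<in> borel_measurable borel" by measurable
  then have J': "?J \<in> borel_measurable lebesgue"
    by (intro measurable_completion) simp
  have AE: "AE x in lebesgue. ?J x = ?I x"
    using AE_deriv_deriv_eq_weak_deriv2 by eventually_elim simp
  \<comment> \<open>Measurability of \<open>deriv (deriv u)\<close> is inherited from
    \<open>w\<close> through almost everywhere equality, by completeness of
    \<open>lebesgue\<close>.\<close>
  have "?I \<in> borel_measurable lebesgue"
    by (rule borel_measurable_AE[OF J' AE])
  then have "Ifun \<beta> c u = integral\<^sup>L lebesgue ?J"
    using AE J' unfolding Ifun_def by (intro integral_cong_AE) auto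
  also have "\<dots> = integral\<^sup>L lborel ?J"
    using J by (intro integral_completion) simp
  also have "\<dots> = (\<integral>x. (w x)\<^sup>2 \<partial>lborel) - \<beta> * (\<integral>x. (deriv u x)\<^sup>2 \<partial>lborel)
     + (1 - c\<^sup>2) * (\<integral>x. (u x)\<^sup>2 \<partial>lborel)"
    using H2_square_integrable weak_deriv2_square_integrable by simp
  finally show ?thesis .
qed

text \<open>Integration by parts on \<open>{-X..X}\<close>. As \<open>X\<close> grows the boundary
  term converges to the integral of \<open>?\<phi>\<close>; being itself integrable in
  \<open>X\<close>, it can only converge to 0.\<close>

lemma H2_integral_deriv_square:
  "(\<integral>x. (deriv u x)\<^sup>2 \<partial>lborel) = - (\<integral>x. u x * w x \<partial>lborel)"
proof -
  let ?\<phi> = "\<lambda>x. (deriv u x)\<^sup>2 + u x * w x"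
  have uw: "integrable lborel (\<lambda>x. u x * w x)" and uu': "integrable lborel (\<lambda>x. u x * deriv u x)"
    by (intro integrable_mult_of_square_integrable H2_square_integrable
        weak_deriv2_square_integrable; measurable)+
  have \<phi>: "integrable lborel ?\<phi>"
    using uw H2_square_integrable by simp
  have cont: "set_integrable lborel {a..b} (deriv u)" for a b
    by (rule set_integrable_of_square_integrable[OF _ H2_square_integrable(2)]) measurable
  have u_diff: "u b - u a = (LBINT t:{a..b}. deriv u t)" if "a \<le> b" for a b
  proof -
    have "(deriv u has_integral (u b - u a)) {a..b}"
      using that H2_has_derivative
      by (intro fundamental_theorem_of_calculus)
        (auto simp flip: has_real_derivative_iff_has_vector_derivative intro: DERIV_subset)
    then show ?thesis
      using set_borel_integral_eq_integral(2)[OF cont] by (simp add: integral_unique)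
  qed
  have "(LBINT x:{-X..X}. ?\<phi> x) = u X * deriv u X - u (- X) * deriv u (- X)" if "0 \<le> X" for X
  proof -
    have "(LBINT x:{-X..X}. deriv u x * deriv u x) + (LBINT x:{-X..X}. u x * w x)
        = u X * deriv u X - u (- X) * deriv u (- X)"
      using that by (intro integral_by_parts_indefinite u_diff weak_deriv2_diff cont
          weak_deriv2_set_integrable) auto
    moreover have "set_integrable lborel {-X..X} (\<lambda>x. (deriv u x)\<^sup>2)"
      "set_integrable lborel {-X..X} (\<lambda>x. u x * w x)"
      using uw H2_square_integrable by (auto simp: set_integrable_def intro!: integrable_mult_indicator[where 'b = real, simplified])
    ultimately show ?thesis
      by (simp add: set_integral_add power2_eq_square)
  qed
  moreover have "((\<lambda>X. LBINT x:{-X..X}. ?\<phi> x) \<longlongrightarrow> (\<integral>x. ?\<phi> x \<partial>lborel)) at_top"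
    unfolding set_lebesgue_integral_def
  proof (rule integral_dominated_convergence_at_top)
    show "integrable lborel (\<lambda>x. norm (?\<phi> x))"
      using \<phi> by (rule integrable_norm)
    show "\<forall>\<^sub>F X in at_top. AE x in lborel. norm (indicator {-X..X} x *\<^sub>R ?\<phi> x) \<le> norm (?\<phi> x)"
      by (intro always_eventually allI AE_I2) (auto simp: indicator_def)
    have "\<forall>\<^sub>F X in at_top. indicator {-X..X} x *\<^sub>R ?\<phi> x = ?\<phi> x" for x
      using eventually_ge_at_top[of "\<bar>x\<bar>"] by eventually_elim (auto simp: indicator_def)
    then show "AE x in lborel. ((\<lambda>X. indicator {-X..X} x *\<^sub>R ?\<phi> x) \<longlongrightarrow> ?\<phi> x) at_top"
      by (intro AE_I2 tendsto_eventually)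
  qed measurable
  ultimately have "((\<lambda>X. u X * deriv u X - u (- X) * deriv u (- X)) \<longlongrightarrow> (\<integral>x. ?\<phi> x \<partial>lborel)) at_top"
    by (elim Lim_transform_eventually) (use eventually_ge_at_top[of 0] in eventually_elim, simp)
  \<comment> \<open>\<open>u * deriv u\<close> is a product of two square-integrable functions, and
    reflection preserves integrability.\<close>
  moreover have "integrable lborel (\<lambda>X. u X * deriv u X - u (- X) * deriv u (- X))"
    using uu' lborel_integrable_real_affine[OF uu', of "-1" 0] by simp
  ultimately have "(\<integral>x. ?\<phi> x \<partial>lborel) = 0"
    by (intro integrable_tendsto_at_top_imp_zero)
  then show ?thesis
    using uw H2_square_integrable by simp
qed

lemma Ifun_nonneg:
  assumes "\<beta> \<le> 2"
  shows "0 \<le> Ifun \<beta> 0 u"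
proof -
  have uw: "integrable lborel (\<lambda>x. u x * w x)"
    by (intro integrable_mult_of_square_integrable H2_square_integrable
        weak_deriv2_square_integrable; measurable)
  have "0 \<le> (\<integral>x. (w x + u x)\<^sup>2 \<partial>lborel) + (2 - \<beta>) * (\<integral>x. (deriv u x)\<^sup>2 \<partial>lborel)"
    using assms by (intro add_nonneg_nonneg mult_nonneg_nonneg integral_nonneg) auto
  also have "(\<lambda>x. (w x + u x)\<^sup>2) = (\<lambda>x. (w x)\<^sup>2 + (u x)\<^sup>2 + 2 * (u x * w x))"
    by (simp add: power2_sum mult_ac)
  also have "(\<integral>x. (w x)\<^sup>2 + (u x)\<^sup>2 + 2 * (u x * w x) \<partial>lborel) =
      (\<integral>x. (w x)\<^sup>2 \<partial>lborel) + (\<integral>x. (u x)\<^sup>2 \<partial>lborel) + 2 * (\<integral>x. u x * w x \<partial>lborel)"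
    using uw H2_square_integrable weak_deriv2_square_integrable by simp
  finally show ?thesis
    using H2_integral_deriv_square by (simp add: Ifun_eq_weak_deriv2 algebra_simps)
qed

end

end

subsection \<open>Scaling\<close>

lemma deriv_rescale:
  fixes u :: "real \<Rightarrow> real"
  assumes "\<And>x. u differentiable (at x)"
  shows "((\<lambda>x. u (r * x)) has_real_derivative r * deriv u (r * x)) (at x)"
proof -
  have "(u has_real_derivative deriv u (r * x)) (at (r * x))"
    using assms by (simp add: DERIV_deriv_iff_real_differentiable)
  moreover have "((\<lambda>x. r * x) has_real_derivative r) (at x)"
    by (auto intro!: derivative_eq_intros)
  ultimately have "((\<lambda>x. u (r * x)) has_real_derivative deriv u (r * x) * r) (at x)"
    by (rule DERIV_chain2)
  then show ?thesis by (simp only: mult.commute[of r "deriv u (r * x)"])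
qed

lemma interval_integral_rescale:
  fixes w :: "real \<Rightarrow> real" and r x :: real
  assumes "0 < r"
  shows "(LBINT t=0..r * x. w t) = r * (LBINT t=0..x. w (r * t))"
proof -
  have rescale: "(LBINT t:{r * a<..<r * b}. w t) = r * (LBINT t:{a<..<b}. w (r * t))" for a b
  proof -
    have "indicator {r * a<..<r * b} (r * t) = (indicator {a<..<b} t :: real)" for t
      using assms by (simp add: indicator_def)
    then show ?thesis
      using assms lborel_integral_real_affine[of r "\<lambda>t. indicator {r * a<..<r * b} t * w t" 0]
      by (simp add: set_lebesgue_integral_def)
  qed
  show ?thesis
  \<comment> \<open>The integral is oriented: for negative \<open>x\<close> it is minus the integral
    over \<open>{x<..<0}\<close>, so the substitution is used with the ends exchanged.\<close>
  proof (cases "0 \<le> x")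
    case True
    then have "0 \<le> r * x" using assms by simp
    with True show ?thesis
      using rescale[of 0 x]
      unfolding interval_lebesgue_integral_def zero_ereal_def einterval_eq by simp
  next
    case False
    then have "\<not> 0 \<le> r * x" using assms by (simp add: zero_le_mult_iff)
    with False show ?thesis
      using rescale[of x 0]
      unfolding interval_lebesgue_integral_def zero_ereal_def einterval_eq by simp
  qed
qed

locale H2_rescale =
  fixes u :: "real \<Rightarrow> real" and r :: real
  assumes H2_u: "H2 u" and r_pos: "0 < r"
begin

lemma differentiable: "u differentiable (at x)"
  using H2_u by (simp add: H2_def)

lemma deriv_eq: "deriv (\<lambda>x. u (r * x)) = (\<lambda>x. r * deriv u (r * x))"
  by (intro ext DERIV_imp_deriv deriv_rescale differentiable)

text \<open>One factor \<open>r\<close> comes from the chain rule for \<open>deriv u\<close>, the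
  other from the substitution in the indefinite integral of \<open>w\<close>.\<close>

lemma weak_deriv2_rescale:
  assumes w: "weak_deriv2 u w"
  shows "weak_deriv2 (\<lambda>x. u (r * x)) (\<lambda>x. r\<^sup>2 * w (r * x))"
  unfolding weak_deriv2_def
proof (intro conjI allI)
  note [measurable] = weak_deriv2_measurable[OF w]
  show "(\<lambda>x. r\<^sup>2 * w (r * x)) \<in> borel_measurable borel"
    by measurable
  show "integrable lborel (\<lambda>x. (r\<^sup>2 * w (r * x))\<^sup>2)"
    using r_pos lborel_integrable_real_affine[OF weak_deriv2_square_integrable[OF w], of r 0]
    by (simp add: power_mult_distrib)
  fix x
  have "deriv u (r * x) - deriv u 0 = (LBINT t=0..r * x. w t)"
    using w unfolding weak_deriv2_def by blast
  then have "deriv u (r * x) - deriv u 0 = r * (LBINT t=0..x. w (r * t))"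
    unfolding interval_integral_rescale[OF r_pos] .
  then have "r * deriv u (r * x) - r * deriv u 0 = r\<^sup>2 * (LBINT t=0..x. w (r * t))"
    unfolding right_diff_distrib[symmetric] power2_eq_square mult.assoc by (rule arg_cong)
  then show "deriv (\<lambda>x. u (r * x)) x - deriv (\<lambda>x. u (r * x)) 0 = (LBINT t=0..x. r\<^sup>2 * w (r * t))"
    unfolding deriv_eq mult_zero_right interval_lebesgue_integral_mult_right .
qed

lemma H2_rescaled: "H2 (\<lambda>x. u (r * x))"
  unfolding H2_iff
proof (intro conjI allI)
  show "(\<lambda>x. u (r * x)) differentiable (at x)" for x
    using deriv_rescale[OF differentiable, of r x] real_differentiable_def by blast
  have "integrable lborel (\<lambda>x. (u x)\<^sup>2)" "integrable lborel (\<lambda>x. (deriv u x)\<^sup>2)"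
    using H2_u by (simp_all add: H2_def)
  from this[THEN lborel_integrable_real_affine, of r 0]
  show "integrable lborel (\<lambda>x. (u (r * x))\<^sup>2)" "integrable lborel (\<lambda>x. (deriv (\<lambda>x. u (r * x)) x)\<^sup>2)"
    using r_pos by (simp_all add: deriv_eq power_mult_distrib)
  obtain w where "weak_deriv2 u w"
    using H2_u unfolding H2_iff by blast
  then show "\<exists>w. weak_deriv2 (\<lambda>x. u (r * x)) w"
    using weak_deriv2_rescale by blast
qed

text \<open>Each derivative contributes \<open>r\<^sup>2\<close> to its square and the change of
  variable contributes \<open>1 / r\<close>. With \<open>1 - c\<^sup>2 = r ^ 4\<close> the outer two
  terms carry the same power \<open>r ^ 3\<close>; the middle one has \<open>r\<close> in its place,
  hence the new parameter \<open>\<beta> / r\<^sup>2\<close>.\<close>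

lemma Ifun_rescaled:
  assumes "1 - c\<^sup>2 = r ^ 4"
  shows "Ifun \<beta> c (\<lambda>x. u (r * x)) = r ^ 3 * Ifun (\<beta> / r\<^sup>2) 0 u"
proof -
  obtain w where w: "weak_deriv2 u w"
    using H2_u unfolding H2_iff by blast
  have rescale: "(\<integral>x. g (r * x) \<partial>lborel) = (\<integral>x. g x \<partial>lborel) / r" for g :: "real \<Rightarrow> real"
    using lborel_integral_real_affine[of r g 0] r_pos by simp
  have "Ifun \<beta> c (\<lambda>x. u (r * x)) = r ^ 4 * ((\<integral>x. (w x)\<^sup>2 \<partial>lborel) / r)
      - \<beta> * (r\<^sup>2 * ((\<integral>x. (deriv u x)\<^sup>2 \<partial>lborel) / r)) + r ^ 4 * ((\<integral>x. (u x)\<^sup>2 \<partial>lborel) / r)"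
    using rescale[of "\<lambda>x. (w x)\<^sup>2"] rescale[of "\<lambda>x. (u x)\<^sup>2"] rescale[of "\<lambda>x. (deriv u x)\<^sup>2"]
    by (simp add: Ifun_eq_weak_deriv2[OF weak_deriv2_rescale[OF w] H2_rescaled]
        deriv_eq power_mult_distrib assms flip: power_mult)
  also have "\<dots> = r ^ 3 * Ifun (\<beta> / r\<^sup>2) 0 u"
    unfolding Ifun_eq_weak_deriv2[OF w H2_u] using r_pos by (simp add: field_simps eval_nat_numeral)
  finally show ?thesis .
qed

lemma Kfun_rescaled: "Kfun p f (\<lambda>x. u (r * x)) = Kfun p f u / r"
  using lebesgue_integral_real_affine[of r "\<lambda>x. Fprim f (u x)" 0] r_pos
  by (simp add: Kfun_def)

end

section \<open>The quotient set under dilation and the homogeneity of \<open>dfun\<close>\<close>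

definition quotients :: "real \<Rightarrow> (real \<Rightarrow> real) \<Rightarrow> real \<Rightarrow> real \<Rightarrow> real set" where
  "quotients p f \<beta> c = {Ifun \<beta> c u / (Kfun p f u) powr (2 / (p + 1)) | u. H2 u \<and> Kfun p f u > 0}"

lemma mfun_eq_Inf_quotients: "mfun p f \<beta> c = Inf (quotients p f \<beta> c)"
  by (simp add: mfun_def quotients_def)

lemma quotients_empty_iff: "quotients p f \<beta> c = {} \<longleftrightarrow> \<not> (\<exists>u. H2 u \<and> Kfun p f u > 0)"
  by (auto simp: quotients_def)

lemma quotient_rescaled:
  assumes "H2 u" "0 < r" "1 - c\<^sup>2 = r ^ 4" "0 < Kfun p f u"
  shows "Ifun \<beta> c (\<lambda>x. u (r * x)) / (Kfun p f (\<lambda>x. u (r * x))) powr q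
    = r ^ 3 * r powr q * (Ifun (\<beta> / r\<^sup>2) 0 u / (Kfun p f u) powr q)"
proof -
  interpret H2_rescale u r using assms by unfold_locales
  show ?thesis
    using assms by (simp add: Ifun_rescaled Kfun_rescaled powr_divide)
qed

text \<open>Dilation by \<open>r\<close> permutes the admissible functions, with inverse the
  dilation by \<open>inverse r\<close>, and multiplies every quotient by the same factor.\<close>

lemma quotients_rescaled:
  assumes r: "0 < r" "1 - c\<^sup>2 = r ^ 4"
  shows "quotients p f \<beta> c = (\<lambda>y. r ^ 3 * r powr (2 / (p + 1)) * y) ` quotients p f (\<beta> / r\<^sup>2) 0"
proof (intro equalityI subsetI)
  fix y assume "y \<in> quotients p f \<beta> c"
  then obtain v where v: "H2 v" "0 < Kfun p f v"
    and y: "y = Ifun \<beta> c v / (Kfun p f v) powr (2 / (p + 1))"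
    by (auto simp: quotients_def)
  define u where "u = (\<lambda>x. v (inverse r * x))"
  interpret v: H2_rescale v "inverse r" using v r by unfold_locales auto
  have u: "H2 u" "0 < Kfun p f u"
    unfolding u_def v.Kfun_rescaled using v(2) r(1) by (simp_all add: v.H2_rescaled)
  have vu: "v = (\<lambda>x. u (r * x))"
    using r(1) by (simp add: u_def flip: mult.assoc)
  show "y \<in> (\<lambda>y. r ^ 3 * r powr (2 / (p + 1)) * y) ` quotients p f (\<beta> / r\<^sup>2) 0"
    unfolding y vu quotient_rescaled[OF u(1) r u(2)]
    by (intro imageI) (unfold quotients_def, use u in blast)
next
  fix y assume "y \<in> (\<lambda>y. r ^ 3 * r powr (2 / (p + 1)) * y) ` quotients p f (\<beta> / r\<^sup>2) 0"
  then obtain u where u: "H2 u" "0 < Kfun p f u"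
    and y: "y = r ^ 3 * r powr (2 / (p + 1)) *
      (Ifun (\<beta> / r\<^sup>2) 0 u / (Kfun p f u) powr (2 / (p + 1)))"
    by (auto simp: quotients_def)
  interpret H2_rescale u r using u r by unfold_locales
  have "0 < Kfun p f (\<lambda>x. u (r * x))"
    using u r by (simp add: Kfun_rescaled)
  with H2_rescaled show "y \<in> quotients p f \<beta> c"
    unfolding y quotient_rescaled[OF u(1) r u(2), symmetric] quotients_def
    by (intro CollectI exI[of _ "\<lambda>x. u (r * x)"]) simp
qed

lemma bdd_below_quotients:
  assumes "\<beta> \<le> 2"
  shows "bdd_below (quotients p f \<beta> 0)"
proof (rule bdd_belowI)
  fix y assume "y \<in> quotients p f \<beta> 0"
  then obtain u where "H2 u" and y: "y = Ifun \<beta> 0 u / (Kfun p f u) powr (2 / (p + 1))"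
    by (auto simp: quotients_def)
  then have "0 \<le> Ifun \<beta> 0 u"
    using Ifun_nonneg[OF _ _ assms] by (auto simp: H2_iff)
  then show "0 \<le> y" by (simp add: y)
qed

text \<open>A monotone map that is right-continuous at the infimum commutes with it;
  \<open>0 < t\<close> gives monotonicity.\<close>

lemma Inf_mult_image:
  fixes A :: "real set"
  assumes "0 < t" "A \<noteq> {}" "bdd_below A"
  shows "Inf ((\<lambda>y. t * y) ` A) = t * Inf A"
proof -
  have "mono (\<lambda>y. t * y)"
    using assms(1) by (auto intro!: monoI mult_left_mono)
  moreover have "continuous (at_right (Inf A)) (\<lambda>y. t * y)"
    by (intro continuous_intros)
  ultimately show ?thesis
    using continuous_at_Inf_mono[of "\<lambda>y. t * y" A] assms(2,3) by simp
qed

text \<open>Origin of \<open>a\<close>: quotients scale with exponent \<open>3 + 2 / (p + 1)\<close>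
  in \<open>r = sqrt \<omega>\<close>, so with half of it in \<open>\<omega>\<close>, and
  \<open>dfun\<close> raises the infimum to the power \<open>(p + 1) / (p - 1)\<close>. The domain
  condition says \<open>\<beta> / \<omega> < 2\<close>, within the range where the quotients are
  bounded below.\<close>

lemma dfun_homogeneous:
  fixes p :: real
  defines "a \<equiv> (3 + 2 / (p + 1)) / 2 * ((p + 1) / (p - 1))"
  assumes "\<exists>u. H2 u \<and> Kfun p f u > 0" and c: "c\<^sup>2 < 1" and \<beta>: "\<beta> < 2 * sqrt (1 - c\<^sup>2)"
  shows "dfun p f \<beta> c = sqrt (1 - c\<^sup>2) powr a * dfun p f (\<beta> / sqrt (1 - c\<^sup>2)) 0"
proof -
  define \<omega> where "\<omega> = sqrt (1 - c\<^sup>2)"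
  define r where "r = sqrt \<omega>"
  have \<omega>: "0 < \<omega>" and r: "0 < r" "r\<^sup>2 = \<omega>"
    using c by (auto simp: \<omega>_def r_def)
  have "1 - c\<^sup>2 = \<omega>\<^sup>2"
    using c by (simp add: \<omega>_def)
  then have c_r: "1 - c\<^sup>2 = r ^ 4"
    using r(2) power_mult[of r 2 2] by simp
  have factor: "r ^ 3 * r powr (2 / (p + 1)) = \<omega> powr ((3 + 2 / (p + 1)) / 2)"
  proof -
    have "r ^ 3 = r powr 3"
      using r by simp
    then have "r ^ 3 * r powr (2 / (p + 1)) = r powr (3 + 2 / (p + 1))"
      by (simp only: powr_add)
    also have "\<dots> = (\<omega> powr (1 / 2)) powr (3 + 2 / (p + 1))"
      using \<omega> by (simp add: r_def powr_half_sqrt)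
    also have "\<dots> = \<omega> powr ((3 + 2 / (p + 1)) / 2)"
      unfolding powr_powr by simp
    finally show ?thesis .
  qed
  have "mfun p f \<beta> c = r ^ 3 * r powr (2 / (p + 1)) * mfun p f (\<beta> / \<omega>) 0"
    unfolding mfun_eq_Inf_quotients quotients_rescaled[OF r(1) c_r] r(2)
  proof (rule Inf_mult_image)
    have "\<beta> / \<omega> \<le> 2"
      using \<beta> \<omega> by (simp add: \<omega>_def[symmetric] field_simps)
    then show "bdd_below (quotients p f (\<beta> / \<omega>) 0)"
      by (rule bdd_below_quotients)
  qed (use assms(2) r in \<open>auto simp: quotients_empty_iff\<close>)
  then have "mfun p f \<beta> c powr ((p + 1) / (p - 1))
      = \<omega> powr a * mfun p f (\<beta> / \<omega>) 0 powr ((p + 1) / (p - 1))"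
    unfolding factor a_def by (simp only: powr_mult powr_powr)
  then show ?thesis
    unfolding dfun_def \<omega>_def[symmetric] by (simp only: mult.left_commute)
qed

subsection \<open>The second derivative along the curve\<close>

text \<open>Chain rule along a horizontal line. It turns differentiability of \<open>dfun\<close> in
  the plane, and of its first partial derivative, into one-variable derivatives of the profile on
  the line \<open>c = 0\<close>.\<close>

lemma has_derivative_partial_fst:
  fixes g :: "real \<times> real \<Rightarrow> real"
  assumes "g differentiable (at (b, c))"
  shows "((\<lambda>t. g (t, c)) has_real_derivative frechet_derivative g (at (b, c)) (1, 0)) (at b)"
proof -
  let ?g' = "frechet_derivative g (at (b, c))"
  have g': "(g has_derivative ?g') (at (b, c))"
    using assms by (simp add: frechet_derivative_works)
  have "((\<lambda>t. (t, c)) has_derivative (\<lambda>t. (t, 0))) (at b)"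
    by (auto intro!: derivative_eq_intros)
  from has_derivative_compose[OF this g']
  have "((\<lambda>t. g (t, c)) has_derivative (\<lambda>t. ?g' (t, 0))) (at b)" .
  moreover have "(\<lambda>t. ?g' (t, 0)) = (*) (?g' (1, 0))"
  proof
    fix t :: real
    have "?g' (t *\<^sub>R (1, 0)) = t *\<^sub>R ?g' (1, 0)"
      by (rule linear_scale[OF has_derivative_linear[OF g']])
    then show "?g' (t, 0) = ?g' (1, 0) * t"
      by (simp add: mult.commute)
  qed
  ultimately show ?thesis
    unfolding has_field_derivative_def by simp
qed

text \<open>The \<open>y\<close>-derivative of a function homogeneous of degree \<open>a\<close> in
  \<open>(b, y)\<close> is homogeneous of degree \<open>a - 1\<close>, with profile
  \<open>\<lambda>x. a * h x - x * h1 x\<close> when \<open>h1\<close> is the derivative of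
  \<open>h\<close>. The rule can therefore be applied again to its own result.\<close>

lemma DERIV_homogeneous:
  fixes h :: "real \<Rightarrow> real"
  assumes "0 < y" and h: "(h has_real_derivative h') (at (b / y))"
  shows "((\<lambda>y. y powr a * h (b / y)) has_real_derivative
    y powr (a - 1) * (a * h (b / y) - b / y * h')) (at y)"
proof -
  have "((\<lambda>y. b / y) has_real_derivative - b / y\<^sup>2) (at y)"
    using assms(1) by (auto intro!: derivative_eq_intros simp: power2_eq_square)
  from DERIV_chain2[where g = "\<lambda>y. b / y", OF h this]
  have "((\<lambda>y. h (b / y)) has_real_derivative h' * (- b / y\<^sup>2)) (at y)" .
  from DERIV_mult[OF has_real_derivative_powr[OF assms(1), of a] this] show ?thesis
    by (rule DERIV_cong)
      (use assms(1) in \<open>simp add: powr_diff power2_eq_square field_simps\<close>)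
qed

text \<open>\<open>DERIV_homogeneous\<close> is applied twice, each time composed with
  \<open>\<omega>\<close>, whose derivative is \<open>- c / \<omega> c\<close>. The first pass has
  profile \<open>P\<close>; the product rule for the factor \<open>- c\<close> then yields one term
  free of \<open>c\<^sup>2\<close> and one proportional to it.\<close>

lemma second_derivative_homogeneous:
  fixes h h1 h2 :: "real \<Rightarrow> real" and d :: "real \<Rightarrow> real \<Rightarrow> real" and a k c :: real
  defines "\<omega> \<equiv> \<lambda>c. sqrt (1 - c\<^sup>2)" and "P \<equiv> \<lambda>x. a * h x - x * h1 x"
  assumes h: "\<And>x. x < 2 \<Longrightarrow> (h has_real_derivative h1 x) (at x)"
    and h1: "\<And>x. x < 2 \<Longrightarrow> (h1 has_real_derivative h2 x) (at x)"
    and d: "\<And>\<beta> c. \<lbrakk>c\<^sup>2 < 1; \<beta> < 2 * \<omega> c\<rbrakk> \<Longrightarrow> d \<beta> c = \<omega> c powr a * h (\<beta> / \<omega> c)"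
    and c: "c\<^sup>2 < 1" and k: "k < 2"
  shows "deriv (deriv (d (k * \<omega> c))) c = \<omega> c powr (a - 4) *
    (c\<^sup>2 * ((a - 1) * P k - k * ((a - 1) * h1 k - k * h2 k)) - P k)"
proof -
  \<comment> \<open>The derivatives in \<open>c\<close> are taken with \<open>\<beta>\<close> frozen
    at its value on the curve, not along the curve.\<close>
  define \<beta> where "\<beta> = k * \<omega> c"
  \<comment> \<open>The formula for the first derivative must hold on a neighbourhood of
    \<open>c\<close> before it can be differentiated; \<open>U\<close> is the open slice of the
    domain at height \<open>\<beta>\<close>.\<close>
  define U where "U = {x. x\<^sup>2 < 1 \<and> \<beta> < 2 * \<omega> x}"
  have "open U"
    unfolding U_def \<omega>_def by (intro open_Collect_conj open_Collect_less continuous_intros)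
  have \<omega>_pos: "0 < \<omega> x" and \<omega>': "(\<omega> has_real_derivative - x / \<omega> x) (at x)" if "x\<^sup>2 < 1" for x
    using that unfolding \<omega>_def
    by (auto intro!: derivative_eq_intros simp: field_simps)
  have "c \<in> U"
    using c k \<omega>_pos[OF c] by (simp add: U_def \<beta>_def)
  have P: "(P has_real_derivative (a - 1) * h1 x - x * h2 x) (at x)" if "x < 2" for x
    unfolding P_def using h[OF that] h1[OF that]
    by (auto intro!: derivative_eq_intros simp: algebra_simps)
  have deriv_d: "deriv (d \<beta>) x = - x * (\<omega> x powr (a - 2) * P (\<beta> / \<omega> x))" if "x \<in> U" for x
  proof (rule DERIV_imp_deriv)
    have x: "x\<^sup>2 < 1" "\<beta> / \<omega> x < 2"
      using that \<omega>_pos by (auto simp: U_def field_simps)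
    have "((\<lambda>x. \<omega> x powr a * h (\<beta> / \<omega> x)) has_real_derivative
        \<omega> x powr (a - 1) * P (\<beta> / \<omega> x) * (- x / \<omega> x)) (at x)"
      unfolding P_def
      using DERIV_chain2[OF DERIV_homogeneous[OF \<omega>_pos[OF x(1)] h[OF x(2)]] \<omega>'[OF x(1)]] .
    moreover have "\<omega> x powr (a - 1) * P (\<beta> / \<omega> x) * (- x / \<omega> x) =
        - x * (\<omega> x powr (a - 2) * P (\<beta> / \<omega> x))"
      using \<omega>_pos[OF x(1)] by (simp add: powr_diff power2_eq_square)
    ultimately have "((\<lambda>x. \<omega> x powr a * h (\<beta> / \<omega> x)) has_real_derivative
        - x * (\<omega> x powr (a - 2) * P (\<beta> / \<omega> x))) (at x)" by simp
    then show "(d \<beta> has_real_derivative - x * (\<omega> x powr (a - 2) * P (\<beta> / \<omega> x))) (at x)"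
      by (rule has_field_derivative_transform_within_open[OF _ \<open>open U\<close> that])
        (simp add: U_def d)
  qed
  let ?R = "(a - 2) * P k - k * ((a - 1) * h1 k - k * h2 k)"
  have \<beta>_c: "\<beta> / \<omega> c = k"
    using \<omega>_pos[OF c] by (simp add: \<beta>_def)
  have "((\<lambda>y. y powr (a - 2) * P (\<beta> / y)) has_real_derivative \<omega> c powr (a - 2 - 1) * ?R) (at (\<omega> c))"
    using DERIV_homogeneous[of "\<omega> c" P _ \<beta> "a - 2", OF \<omega>_pos[OF c] P] k unfolding \<beta>_c by blast
  from DERIV_chain2[OF this \<omega>'[OF c]]
  have "((\<lambda>x. \<omega> x powr (a - 2) * P (\<beta> / \<omega> x)) has_real_derivative
      \<omega> c powr (a - 2 - 1) * ?R * (- c / \<omega> c)) (at c)" .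
  from DERIV_mult[OF DERIV_minus[OF DERIV_ident] this]
  have "((\<lambda>x. - x * (\<omega> x powr (a - 2) * P (\<beta> / \<omega> x))) has_real_derivative
      - 1 * (\<omega> c powr (a - 2) * P k) + \<omega> c powr (a - 2 - 1) * ?R * (- c / \<omega> c) * - c) (at c)"
    unfolding \<beta>_c .
  then have "(deriv (d \<beta>) has_real_derivative
      - 1 * (\<omega> c powr (a - 2) * P k) + \<omega> c powr (a - 2 - 1) * ?R * (- c / \<omega> c) * - c) (at c)"
    by (rule has_field_derivative_transform_within_open[OF _ \<open>open U\<close> \<open>c \<in> U\<close>]) (simp add: deriv_d)
  then have 1: "deriv (deriv (d \<beta>)) c =
      - (\<omega> c powr (a - 2) * P k) + c\<^sup>2 * (\<omega> c powr (a - 2 - 1) / \<omega> c) * ?R"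
    by (simp add: DERIV_imp_deriv power2_eq_square)
  have 2: "\<omega> c powr (a - 2 - 1) / \<omega> c = \<omega> c powr (a - 4)"
    using \<omega>_pos[OF c] powr_diff[of "\<omega> c" "a - 3" 1] by simp
  \<comment> \<open>Bringing both terms to the power \<open>a - 4\<close> adds one
    \<open>P k\<close> to the coefficient of \<open>c\<^sup>2\<close>, which changes
    \<open>a - 2\<close> in \<open>?R\<close> to \<open>a - 1\<close>.\<close>
  have 3: "\<omega> c powr (a - 2) = \<omega> c powr (a - 4) * (1 - c\<^sup>2)"
    using c \<omega>_pos[OF c] powr_add[of "\<omega> c" "a - 4" 2] by (simp add: \<omega>_def)
  show ?thesis
    unfolding \<beta>_def[symmetric] 1 2 3 by (simp add: algebra_simps)
qed

text \<open>Alternating signs would make the middle value a strict extremum, so the two increments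
  would have opposite signs; for an affine function their product is
  \<open>(y - x) * (z - y) * A\<^sup>2\<close>, which is nonnegative.\<close>

lemma affine_no_two_sign_changes:
  fixes A B x y z :: real
  assumes "x < y" "y < z" and "(x * A - B) * (y * A - B) < 0" "(y * A - B) * (z * A - B) < 0"
  shows False
proof -
  define e1 e2 e3 where "e1 = x * A - B" and "e2 = y * A - B" and "e3 = z * A - B"
  have "0 \<le> ((y - x) * (z - y)) * (A * A)"
    using assms(1,2) by (intro mult_nonneg_nonneg[OF mult_nonneg_nonneg zero_le_square]) auto
  also have "\<dots> = (e2 - e1) * (e3 - e2)"
    by (simp add: e1_def e2_def e3_def algebra_simps)
  finally have nonneg: "0 \<le> (e2 - e1) * (e3 - e2)" .
  have "e1 * e2 < 0" "e2 * e3 < 0"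
    using assms(3,4) by (simp_all add: e1_def e2_def e3_def)
  then have "e1 < e2 \<and> e3 < e2 \<or> e2 < e1 \<and> e2 < e3"
    unfolding mult_less_0_iff by linarith
  then have "(e2 - e1) * (e3 - e2) < 0"
    using mult_pos_neg[of "e2 - e1" "e3 - e2"] mult_neg_pos[of "e2 - e1" "e3 - e2"] by auto
  with nonneg show False by simp
qed

theorem mainTheorem19:
  fixes p k :: real and f :: "real \<Rightarrow> real"
  assumes hp: "p > 1"
    and hf: "C2_fun f"
    and hhom: "\<forall>t>0. \<forall>s. f (t * s) = t powr p * f s"
    and hF: "\<exists>s. Fprim f s > 0"
    and hd: "twice_differentiable_on (\<lambda>z. dfun p f (fst z) (snd z)) dom_d"
    and hk: "k < 2"
  shows "\<not> (\<exists>c1 c2 c3. 0 \<le> c1 \<and> c1 < c2 \<and> c2 < c3 \<and> c3 < 1 \<and>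
            d_cc p f (k * sqrt (1 - c1\<^sup>2)) c1 * d_cc p f (k * sqrt (1 - c2\<^sup>2)) c2 < 0 \<and>
            d_cc p f (k * sqrt (1 - c2\<^sup>2)) c2 * d_cc p f (k * sqrt (1 - c3\<^sup>2)) c3 < 0)"
proof (cases "\<exists>u. H2 u \<and> Kfun p f u > 0")
  case False
  text \<open>Then \<open>m\<close> is the infimum of the empty set, a junk value independent of \<open>\<beta>\<close> and \<open>c\<close>.\<close>
  then have "quotients p f \<beta> c = {}" for \<beta> c
    by (simp add: quotients_empty_iff)
  then have "d_cc p f \<beta> c = 0" for \<beta> c
    by (simp add: d_cc_def dfun_def mfun_eq_Inf_quotients)
  then show ?thesis by simp
next
  case True
  define g where "g = (\<lambda>z. dfun p f (fst z) (snd z))"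
  define g1 where "g1 = (\<lambda>z. frechet_derivative g (at z) (1, 0))"
  \<comment> \<open>The line \<open>c = 0\<close> meets the domain exactly where
    \<open>b < 2\<close>; there \<open>h1\<close> and \<open>h2\<close> are the first and second
    derivatives of the profile \<open>h\<close>.\<close>
  define h where "h = (\<lambda>b. g (b, 0))"
  define h1 where "h1 = (\<lambda>b. g1 (b, 0))"
  define h2 where "h2 = (\<lambda>b. frechet_derivative g1 (at (b, 0)) (1, 0))"
  define a where "a = (3 + 2 / (p + 1)) / 2 * ((p + 1) / (p - 1))"
  define P where "P = a * h k - k * h1 k"
  define A where "A = (a - 1) * P - k * ((a - 1) * h1 k - k * h2 k)"
  have g: "g differentiable (at (b, 0))" "g1 differentiable (at (b, 0))" if "b < 2" for b
    using hd that by (auto simp: twice_differentiable_on_def dom_d_def g_def g1_def)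
  have h: "(h has_real_derivative h1 b) (at b)" "(h1 has_real_derivative h2 b) (at b)"
    if "b < 2" for b
    using has_derivative_partial_fst[OF g(1)[OF that]] has_derivative_partial_fst[OF g(2)[OF that]]
    by (simp_all add: h_def h1_def h2_def g1_def)
  have d_cc: "d_cc p f (k * sqrt (1 - c\<^sup>2)) c = sqrt (1 - c\<^sup>2) powr (a - 4) * (c\<^sup>2 * A - P)"
    if "c\<^sup>2 < 1" for c
    using second_derivative_homogeneous[of h h1 h2 "dfun p f" a c k, OF h _ that hk]
      dfun_homogeneous[OF True]
    by (simp add: d_cc_def a_def h_def g_def P_def A_def)
  show ?thesis
  proof (safe, goal_cases)
    case (1 c1 c2 c3)
    \<comment> \<open>Squaring preserves the order since \<open>0 \<le> c1\<close>, so the affine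
      variable \<open>c\<^sup>2\<close> takes three increasing values.\<close>
    have sq: "c1\<^sup>2 < c2\<^sup>2" "c2\<^sup>2 < c3\<^sup>2" "c3\<^sup>2 < 1"
      using 1 by (auto simp: abs_square_less_1 intro!: power_strict_mono)
    have pos: "0 < sqrt (1 - c\<^sup>2) powr (a - 4)" if "c\<^sup>2 < 1" for c :: real
      using that by simp
    \<comment> \<open>The positive powers of \<open>sqrt (1 - c\<^sup>2)\<close> do not affect the
      sign, which leaves the affine factors.\<close>
    have "(x\<^sup>2 * A - P) * (y\<^sup>2 * A - P) < 0"
      if "x\<^sup>2 < 1" "y\<^sup>2 < 1"
        "d_cc p f (k * sqrt (1 - x\<^sup>2)) x * d_cc p f (k * sqrt (1 - y\<^sup>2)) y < 0" for x y
    proof -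
      have "sqrt (1 - x\<^sup>2) powr (a - 4) * sqrt (1 - y\<^sup>2) powr (a - 4) *
          ((x\<^sup>2 * A - P) * (y\<^sup>2 * A - P)) < 0"
        using that(3) unfolding d_cc[OF that(1)] d_cc[OF that(2)] by (simp only: mult_ac)
      then show ?thesis
        using mult_pos_pos[OF pos[OF that(1)] pos[OF that(2)]]
        by (metis mult_less_0_iff order_less_asym)
    qed
    then have "(c1\<^sup>2 * A - P) * (c2\<^sup>2 * A - P) < 0" "(c2\<^sup>2 * A - P) * (c3\<^sup>2 * A - P) < 0"
      using 1(5,6) sq by auto
    then show False
      using affine_no_two_sign_changes[OF sq(1,2)] by blast
  qed
qed

end
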